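(* Let $k$ be a positive integer, let $G$ be a finite graph and let $X,Y\subseteq V(G)$. Suppose there exists a collection $\mathcal P$ of at least $16k$ pairwise vertex-disjoint $X$-$Y$-paths in $G$ such that every vertex in $V(\mathcal P)$ is incident to at most one edge in $E(G)\setminus E(\mathcal P)$. Then there exist at least $k$ pairwise non-adjacent $X$-$Y$-paths in $G$.
   Context: An $X$-$Y$-path is a path with one endpoint in $X$ and the other endpoint in $Y$; a single vertex of $X\cap Y$ counts as an $X$-$Y$-path (of length $0$). For a collection $\mathcal P$ of paths, $V(\mathcal P)=\bigcup_{P\in\mathcal P}V(P)$ and $E(\mathcal P)=\bigcup_{P\in\mathcal P}E(P)$. Paths are called pairwise non-adjacent if they are pairwise vertex-disjoint and there is no edge of $G$ joining a vertex of one of them to a vertex of another. *)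

theory Defs
  imports Main
begin

text \<open>Finite simple undirected graphs, with edges as two-element sets of vertices.\<close>

locale finite_graph =
  fixes V :: "'a set" and E :: "'a set set"
  assumes finite_verts: "finite V"
    and edges_wf: "\<And>e. e \<in> E \<Longrightarrow> e \<subseteq> V \<and> card e = 2"

text \<open>
  A path is given by the list of its vertices in one of the two orders of traversal; its
  vertex set is \<open>set p\<close>. The one-element lists are the paths of length 0.
\<close>

definition path_edges :: "'a list \<Rightarrow> 'a set set" where
  "path_edges p = {{p ! i, p ! Suc i} | i. Suc i < length p}"

definition is_path :: "'a set \<Rightarrow> 'a set set \<Rightarrow> 'a list \<Rightarrow> bool" where
  "is_path V E p \<longleftrightarrow> p \<noteq> [] \<and> distinct p \<and> set p \<subseteq> V \<and> path_edges p \<subseteq> E"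

text \<open>The disjunction reflects that the order of traversal of a path carries no meaning.\<close>

definition XY_path :: "'a set \<Rightarrow> 'a set \<Rightarrow> 'a set \<Rightarrow> 'a set set \<Rightarrow> 'a list \<Rightarrow> bool" where
  "XY_path X Y V E p \<longleftrightarrow> is_path V E p \<and>
     (hd p \<in> X \<and> last p \<in> Y \<or> hd p \<in> Y \<and> last p \<in> X)"

definition verts_of :: "'a list set \<Rightarrow> 'a set" where
  "verts_of P = (\<Union>p\<in>P. set p)"

definition edges_of :: "'a list set \<Rightarrow> 'a set set" where
  "edges_of P = (\<Union>p\<in>P. path_edges p)"

definition vertex_disjoint :: "'a list \<Rightarrow> 'a list \<Rightarrow> bool" where
  "vertex_disjoint p q \<longleftrightarrow> set p \<inter> set q = {}"

definition non_adjacent :: "'a set set \<Rightarrow> 'a list \<Rightarrow> 'a list \<Rightarrow> bool" where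
  "non_adjacent E p q \<longleftrightarrow> vertex_disjoint p q \<and> (\<forall>u\<in>set p. \<forall>v\<in>set q. {u, v} \<notin> E)"

end

theory Submission
  imports Defs
begin

text \<open>
  Let \<open>M\<close> be the set of edges outside the given paths that join two of their vertices; it is a
  matching. Call two edges of \<open>M\<close> in conflict if some edge of a path joins them. Among any edges of
  \<open>M\<close>, one that contains the first of their vertices on some path has at most three conflicts,
  so \<open>M\<close> has a conflict-free colouring with four colours.

  For one colour class, view every edge of the class as a crossing of two directed paths, which has
  two incoming and two outgoing arcs. Since a union of two matchings is bipartite, the arcs can be
  2-coloured so that at each crossing the two incoming arcs differ, and so do the two outgoing
  ones. Each of the two colours is then a system of directed paths (and cycles) that passes each
  crossing exactly once, and one of them keeps at least half of the starting points. An edge of an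
  old path cannot become an edge between two new ones, because its ends would both lie in the
  current colour class. Four such halvings turn \<open>16 k\<close> paths into \<open>k\<close> paths whose vertices span
  no further edges.

  A path system is represented by a vertex set \<open>U\<close> and an injective partial function \<open>F\<close> on it,
  given as a set of arcs. Its paths start in \<open>U - Range F\<close> and end in \<open>U - Domain F\<close>; cycles are
  allowed. A matching is represented by an involution \<open>m\<close> that fixes the unmatched vertices.
\<close>

section \<open>Two-colouring a union of two matchings\<close>

definition bicolours :: "('n \<Rightarrow> bool) \<Rightarrow> ('n \<Rightarrow> 'n) \<Rightarrow> bool" where
  "bicolours d f \<longleftrightarrow> (\<forall>x. f x \<noteq> x \<longrightarrow> d (f x) \<noteq> d x)"

text \<open>The pairs swapped by \<open>f\<close> and by \<open>g\<close> form two matchings, whose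
  union has no odd cycle. The induction deletes one pair \<open>{a, b}\<close> of \<open>f\<close>
  and, where needed, repairs \<open>g\<close> around it so that a colouring of the rest
  extends.\<close>

lemma two_involutions_bicolouring:
  fixes f g :: "'n \<Rightarrow> 'n"
  assumes "finite {x. f x \<noteq> x}" and "\<And>x. f (f x) = x" and "\<And>x. g (g x) = x"
  shows "\<exists>d. bicolours d f \<and> bicolours d g"
  using assms
proof (induction "card {x. f x \<noteq> x}" arbitrary: f g rule: less_induct)
  case less
  note fin = less.prems(1) and ff = less.prems(2) and gg = less.prems(3)
  show ?case
  proof (cases "\<exists>a. f a \<noteq> a")
    case False
    \<comment> \<open>Only \<open>g\<close> constrains here. The choice depends only on the set
      \<open>{x, g x}\<close>, so exactly one member of each pair is the chosen one.\<close>
    define d where "d x = (x = (SOME y. y \<in> {x, g x}))" for x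
    have "d (g x) \<noteq> d x" if "g x \<noteq> x" for x
    proof -
      have "{g x, g (g x)} = {x, g x}" using gg by auto
      moreover have "(SOME y. y \<in> {x, g x}) \<in> {x, g x}" by (rule someI[of _ x]) simp
      ultimately show ?thesis using that unfolding d_def by auto
    qed
    then have "bicolours d f \<and> bicolours d g" using False unfolding bicolours_def by simp
    then show ?thesis by blast
  next
    case True
    then obtain a where a: "f a \<noteq> a" by blast
    define b where "b = f a"
    have ab: "a \<noteq> b" "f a = b" "f b = a" using a ff b_def by auto
    have fx: "f x \<noteq> a" "f x \<noteq> b" if "x \<noteq> a" "x \<noteq> b" for x using ff ab that by metis+
    define f' where "f' = f(a := a, b := b)"
    have f'f': "f' (f' x) = x" for x
      using ff[of x] fx[of x] ab unfolding f'_def by auto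
    have sub: "{x. f' x \<noteq> x} \<subset> {x. f x \<noteq> x}"
      using a unfolding f'_def by auto
    have fin': "finite {x. f' x \<noteq> x}" using sub fin by (meson finite_subset psubset_imp_subset)
    have IH: "\<exists>d. bicolours d f' \<and> bicolours d h"
      if "\<And>x. h (h x) = x" for h
      using less.hyps[OF psubset_card_mono[OF fin sub] fin' f'f' that] .
    \<comment> \<open>Either \<open>g\<close> swaps \<open>a\<close> and \<open>b\<close> as well,
      or it fixes one of them, which can then be recoloured freely, or it matches both
      elsewhere.\<close>
    consider "g a = b" | "g a = a" | "g b = b" | "g a \<noteq> b" "g a \<noteq> a" "g b \<noteq> b" by blast
    then show ?thesis
    proof cases
      case 1
      obtain d where "bicolours d f'" "bicolours d g" using IH[OF gg] by blast
      then have d: "(f' x \<noteq> x \<longrightarrow> d (f' x) \<noteq> d x) \<and> (g x \<noteq> x \<longrightarrow> d (g x) \<noteq> d x)" for x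
        unfolding bicolours_def by simp
      have "d a \<noteq> d b" using d[of a] 1 ab by auto
      then have "f x \<noteq> x \<longrightarrow> d (f x) \<noteq> d x" for x
        using d[of x] ab unfolding f'_def by (cases "x = a"; cases "x = b") auto
      then show ?thesis using \<open>bicolours d g\<close> by (intro exI[of _ d]) (simp add: bicolours_def)
    next
      case 2
      obtain d where "bicolours d f'" "bicolours d g" using IH[OF gg] by blast
      then have d: "(f' x \<noteq> x \<longrightarrow> d (f' x) \<noteq> d x) \<and> (g x \<noteq> x \<longrightarrow> d (g x) \<noteq> d x)" for x
        unfolding bicolours_def by simp
      have ga: "g x \<noteq> a" if "x \<noteq> a" for x using gg 2 that by metis
      have "((f x \<noteq> x \<longrightarrow> (d(a := \<not> d b)) (f x) \<noteq> (d(a := \<not> d b)) x) \<and>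
        (g x \<noteq> x \<longrightarrow> (d(a := \<not> d b)) (g x) \<noteq> (d(a := \<not> d b)) x))" for x
        using d[of x] ab ga[of x] fx[of x] 2 unfolding f'_def
        by (cases "x = a"; cases "x = b") auto
      then show ?thesis by (intro exI[of _ "d(a := \<not> d b)"]) (simp add: bicolours_def del: fun_upd_apply)
    next
      case 3
      obtain d where "bicolours d f'" "bicolours d g" using IH[OF gg] by blast
      then have d: "(f' x \<noteq> x \<longrightarrow> d (f' x) \<noteq> d x) \<and> (g x \<noteq> x \<longrightarrow> d (g x) \<noteq> d x)" for x
        unfolding bicolours_def by simp
      have gb: "g x \<noteq> b" if "x \<noteq> b" for x using gg 3 that by metis
      have "((f x \<noteq> x \<longrightarrow> (d(b := \<not> d a)) (f x) \<noteq> (d(b := \<not> d a)) x) \<and>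
        (g x \<noteq> x \<longrightarrow> (d(b := \<not> d a)) (g x) \<noteq> (d(b := \<not> d a)) x))" for x
        using d[of x] ab gb[of x] fx[of x] 3 unfolding f'_def
        by (cases "x = a"; cases "x = b") auto
      then show ?thesis by (intro exI[of _ "d(b := \<not> d a)"]) (simp add: bicolours_def del: fun_upd_apply)
    next
      case 4
      define a' where "a' = g a"
      define b' where "b' = g b"
      have ne: "a' \<noteq> a" "a' \<noteq> b" "b' \<noteq> a" "b' \<noteq> b" "a' \<noteq> b'" "g a = a'" "g a' = a" "g b = b'" "g b' = b"
        using 4 ab gg unfolding a'_def b'_def by metis+
      have gx: "g x \<noteq> a" "g x \<noteq> b" "g x \<noteq> a'" "g x \<noteq> b'"
        if "x \<noteq> a" "x \<noteq> b" "x \<noteq> a'" "x \<noteq> b'" for x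
        using gg ne that by metis+
      \<comment> \<open>The alternating path \<open>a'\<close>, \<open>a\<close>, \<open>b\<close>,
        \<open>b'\<close> is shortened to the single edge from \<open>a'\<close> to
        \<open>b'\<close>. Three edges become one, so parity is preserved, and \<open>a\<close> and
        \<open>b\<close> can later be coloured against their partners.\<close>
      define g' where "g' = g(a := a, b := b, a' := b', b' := a')"
      have g'g': "g' (g' x) = x" for x
        using ne gx[of x] gg[of x] ab unfolding g'_def
        by (cases "x = a"; cases "x = b"; cases "x = a'"; cases "x = b'") auto
      obtain d where "bicolours d f'" "bicolours d g'" using IH[OF g'g'] by blast
      then have d: "(f' x \<noteq> x \<longrightarrow> d (f' x) \<noteq> d x) \<and> (g' x \<noteq> x \<longrightarrow> d (g' x) \<noteq> d x)" for x
        unfolding bicolours_def by simp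
      define d' where "d' = d(a := \<not> d a', b := \<not> d b')"
      have dab: "d a' \<noteq> d b'" using d[of a'] ne unfolding g'_def by auto
      have "f x \<noteq> x \<longrightarrow> d' (f x) \<noteq> d' x" for x
        using d[of x] ab fx[of x] dab unfolding f'_def d'_def
        by (cases "x = a"; cases "x = b") auto
      moreover have "g x \<noteq> x \<longrightarrow> d' (g x) \<noteq> d' x" for x
        using d[of x] ab ne gx[of x] unfolding g'_def d'_def
        by (cases "x = a"; cases "x = b"; cases "x = a'"; cases "x = b'") auto
      ultimately show ?thesis by (intro exI[of _ d']) (simp add: bicolours_def)
    qed
  qed
qed

section \<open>Halving a path system along a matching\<close>

text \<open>The pairs \<open>{x, m x}\<close> are the crossings. One colour class of arcs is kept
  and completed by the crossing edges at which it changes vertex. The last two conclusions say that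
  no arc of \<open>F\<close> and no crossing edge between kept vertices is lost; for arcs this rests
  on \<open>sep\<close>.\<close>

lemma halve_linear_arcs:
  fixes U :: "'a set" and F :: "('a \<times> 'a) set" and m :: "'a \<Rightarrow> 'a"
  assumes "finite U" and FU: "F \<subseteq> U \<times> U" and sv: "single_valued F" and svi: "single_valued (F\<inverse>)"
    and mm: "\<And>x. m (m x) = x" and mU: "\<And>x. m x \<noteq> x \<Longrightarrow> x \<in> U"
    and sep: "\<And>x y. (x, y) \<in> F \<Longrightarrow> m x = x \<or> m y = y"
  shows "\<exists>U' F'. U' \<subseteq> U \<and> F' \<subseteq> U' \<times> U' \<and> single_valued F' \<and> single_valued (F'\<inverse>) \<and>
    F' \<subseteq> F \<union> {(x, m x) | x. m x \<noteq> x} \<and>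
    U' - Range F' \<subseteq> U - Range F \<and> U' - Domain F' \<subseteq> U - Domain F \<and>
    card (U - Range F) \<le> 2 * card (U' - Range F') \<and>
    (\<forall>x y. (x, y) \<in> F \<longrightarrow> x \<in> U' \<longrightarrow> y \<in> U' \<longrightarrow> (x, y) \<in> F') \<and>
    (\<forall>x. m x \<noteq> x \<longrightarrow> x \<in> U' \<longrightarrow> m x \<in> U' \<longrightarrow> (x, m x) \<in> F' \<or> (m x, x) \<in> F')"
proof -
  have svD: "y = z" if "(x, y) \<in> F" "(x, z) \<in> F" for x y z using sv that by (meson single_valuedD)
  have sviD: "y = z" if "(y, x) \<in> F" "(z, x) \<in> F" for x y z using svi that by (meson converseI single_valuedD)
  \<comment> \<open>The half-arc entering \<open>u\<close> is \<open>(u, False)\<close>, the one leaving it is \<open>(u, True)\<close>. The colour of the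
    latter is negated below, so that both "same arc" and "same path through an unmatched vertex"
    become inequality constraints, like those at a crossing.\<close>
  define f :: "'a \<times> bool \<Rightarrow> 'a \<times> bool" where "f = (\<lambda>(u, b).
    if b then (if u \<in> Domain F then (THE v. (u, v) \<in> F, False) else (u, b))
    else (if u \<in> Range F then (THE v. (v, u) \<in> F, True) else (u, b)))"
  define g :: "'a \<times> bool \<Rightarrow> 'a \<times> bool" where
    "g = (\<lambda>(u, b). if m u = u then (u, \<not> b) else (m u, b))"
  have f_out: "f (u, True) = (v, False)" and f_in: "f (v, False) = (u, True)" if "(u, v) \<in> F" for u v
  proof -
    have "(THE v. (u, v) \<in> F) = v" using that svD by blast
    moreover have "(THE u. (u, v) \<in> F) = u" using that sviD by blast
    ultimately show "f (u, True) = (v, False)" "f (v, False) = (u, True)"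
      using that unfolding f_def by auto
  qed
  have f_id: "u \<notin> Domain F \<Longrightarrow> f (u, True) = (u, True)" "u \<notin> Range F \<Longrightarrow> f (u, False) = (u, False)" for u
    unfolding f_def by auto
  have ff: "f (f x) = x" for x
  proof (cases x)
    case (Pair u b)
    show ?thesis
    proof (cases b)
      case True
      then show ?thesis using Pair f_out f_in f_id by (cases "u \<in> Domain F") (auto simp: Domain_iff)
    next
      case False
      then show ?thesis using Pair f_out f_in f_id by (cases "u \<in> Range F") (auto simp: Range_iff)
    qed
  qed
  have "{x. f x \<noteq> x} \<subseteq> U \<times> UNIV"
  proof
    fix x assume x: "x \<in> {x. f x \<noteq> x}"
    obtain u b where "x = (u, b)" by (cases x)
    then show "x \<in> U \<times> UNIV" using x f_id[of u] FU by (cases b) auto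
  qed
  then have fin: "finite {x. f x \<noteq> x}"
    using \<open>finite U\<close> by (meson finite_SigmaI finite_UNIV finite_subset)
  have gg: "g (g x) = x" for x unfolding g_def using mm by (auto split: prod.splits)
  obtain d where "bicolours d f" "bicolours d g"
    using two_involutions_bicolouring[OF fin ff gg] by blast
  then have d: "f x \<noteq> x \<Longrightarrow> d (f x) \<noteq> d x" "g x \<noteq> x \<Longrightarrow> d (g x) \<noteq> d x" for x
    unfolding bicolours_def by blast+
  \<comment> \<open>These are the colours of the arcs entering and leaving \<open>u\<close>. At a
    source or sink the missing arc is a half-arc fixed by \<open>f\<close> but still coloured, so
    every source has a colour by which it can be counted.\<close>
  define ci where "ci u = d (u, False)" for u
  define co where "co u = (\<not> d (u, True))" for u
  have arc: "co u = ci v" if "(u, v) \<in> F" for u v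
    using d(1)[of "(u, True)"] f_out[OF that] unfolding ci_def co_def by auto
  have free: "ci u = co u" if "m u = u" for u
    using d(2)[of "(u, True)"] that unfolding g_def ci_def co_def by auto
  have bag: "ci (m u) \<noteq> ci u" "co (m u) \<noteq> co u" if "m u \<noteq> u" for u
    using d(2)[of "(u, True)"] d(2)[of "(u, False)"] that unfolding g_def ci_def co_def by auto
  have "card (U - Range F) = card {u \<in> U - Range F. ci u} + card {u \<in> U - Range F. \<not> ci u}"
    using \<open>finite U\<close> by (subst card_Un_disjoint[symmetric]) (auto intro: arg_cong[where f = card])
  then have "\<exists>\<kappa>. card (U - Range F) \<le> 2 * card {u \<in> U - Range F. ci u = \<kappa>}"
  proof (cases "card {u \<in> U - Range F. ci u} \<ge> card {u \<in> U - Range F. \<not> ci u}")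
    case True
    then show ?thesis using \<open>card (U - Range F) = _\<close> by (intro exI[of _ True]) simp
  next
    case False
    then show ?thesis using \<open>card (U - Range F) = _\<close> by (intro exI[of _ False]) simp
  qed
  then obtain \<kappa> where \<kappa>: "card (U - Range F) \<le> 2 * card {u \<in> U - Range F. ci u = \<kappa>}" by blast
  \<comment> \<open>At each crossing the colour \<kappa> enters at one end and leaves at one end. If
    these agree, the path passes through that vertex and the other end is dropped; otherwise it uses
    the crossing edge.\<close>
  define U' where "U' = {u \<in> U. ci u = \<kappa> \<or> co u = \<kappa>}"
  define F' where "F' = {(u, v) \<in> F. co u = \<kappa>} \<union> {(u, m u) | u. m u \<noteq> u \<and> ci u = \<kappa> \<and> co u \<noteq> \<kappa>}"
  have mU2: "m x \<in> U" if "m x \<noteq> x" for x using mU[of "m x"] mm that by metis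
  have F'U': "F' \<subseteq> U' \<times> U'"
    using FU arc bag mU mU2 unfolding F'_def U'_def by auto
  have sv': "single_valued F'"
    unfolding single_valued_def F'_def using svD by auto
  have svi': "single_valued (F'\<inverse>)"
  proof (rule single_valuedI)
    fix x y z assume y: "(x, y) \<in> F'\<inverse>" and z: "(x, z) \<in> F'\<inverse>"
    \<comment> \<open>The value \<open>ci x\<close> decides whether \<open>x\<close> is entered by
      an old arc or by a crossing edge, so the two kinds never compete.\<close>
    have *: "(a, x) \<in> F \<and> ci x = \<kappa> \<or> a = m x \<and> ci x \<noteq> \<kappa>" if "(a, x) \<in> F'" for a
      using that arc bag mm unfolding F'_def by auto
    show "y = z" using *[of y] *[of z] y z sviD by auto
  qed
  have inU': "x \<in> Range F'" if "x \<in> U'" "ci x \<noteq> \<kappa>" for x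
  proof -
    have nx: "m x \<noteq> x" using that free[of x] unfolding U'_def by auto
    have "(m x, m (m x)) \<in> F'"
      using that bag[OF nx] nx mm unfolding F'_def U'_def by auto
    then show ?thesis using mm by (auto simp: Range_iff)
  qed
  have outU': "x \<in> Domain F'" if "x \<in> U'" "co x \<noteq> \<kappa>" for x
  proof -
    have nx: "m x \<noteq> x" using that free[of x] unfolding U'_def by auto
    have "(x, m x) \<in> F'"
      using that nx unfolding F'_def U'_def by auto
    then show ?thesis by blast
  qed
  \<comment> \<open>A kept vertex whose incoming colour is not \<kappa> is entered by a crossing
    edge, so only old sources of colour \<kappa> remain, at least half of all.\<close>
  have src: "U' - Range F' = {u \<in> U - Range F. ci u = \<kappa>}"
  proof (intro equalityI subsetI)
    fix x assume x: "x \<in> U' - Range F'"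
    then have "ci x = \<kappa>" using inU' by blast
    moreover have "x \<notin> Range F"
      using x calculation arc unfolding F'_def by (auto simp: Range_iff)
    ultimately show "x \<in> {u \<in> U - Range F. ci u = \<kappa>}" using x unfolding U'_def by auto
  next
    fix x assume "x \<in> {u \<in> U - Range F. ci u = \<kappa>}"
    then show "x \<in> U' - Range F'" using bag unfolding U'_def F'_def by auto
  qed
  have snk: "U' - Domain F' \<subseteq> U - Domain F"
  proof
    fix x assume x: "x \<in> U' - Domain F'"
    then have "co x = \<kappa>" using outU' by blast
    then have "x \<notin> Domain F" using x unfolding F'_def by auto
    then show "x \<in> U - Domain F" using x unfolding U'_def by auto
  qed
  \<comment> \<open>At both ends of a lost arc between kept vertices, incoming and outgoing colours
    would differ. This happens only at matched vertices, against \<open>sep\<close>.\<close>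
  have keep: "(x, y) \<in> F'" if "(x, y) \<in> F" "x \<in> U'" "y \<in> U'" for x y
  proof (cases "co x = \<kappa>")
    case True
    then show ?thesis using that unfolding F'_def by auto
  next
    case False
    then have "ci x \<noteq> co x" "ci y \<noteq> co y" using that arc unfolding U'_def by auto
    then show ?thesis using free sep[OF that(1)] by blast
  qed
  have cross: "(x, m x) \<in> F' \<or> (m x, x) \<in> F'" if "m x \<noteq> x" "x \<in> U'" "m x \<in> U'" for x
  proof (cases "ci x = \<kappa>")
    case True
    then have "co x \<noteq> \<kappa>" using that bag[OF that(1)] unfolding U'_def by auto
    then show ?thesis using True that unfolding F'_def by auto
  next
    case False
    then have "(m x, m (m x)) \<in> F'"
      using that bag[OF that(1)] mm unfolding F'_def U'_def by auto
    then show ?thesis using mm by simp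
  qed
  have "F' \<subseteq> F \<union> {(x, m x) | x. m x \<noteq> x}" unfolding F'_def by auto
  moreover have "U' \<subseteq> U" unfolding U'_def by auto
  moreover have "U' - Range F' \<subseteq> U - Range F" using src by auto
  moreover have "card (U - Range F) \<le> 2 * card (U' - Range F')" using \<kappa> src by simp
  ultimately show ?thesis using F'U' sv' svi' snk keep cross by blast
qed

section \<open>Removing the matching colour by colour\<close>

text \<open>An edge colouring of the matching, stored at the ends of its edges.\<close>

definition conflict_free :: "('a \<times> 'a) set \<Rightarrow> ('a \<Rightarrow> 'a) \<Rightarrow> ('a \<Rightarrow> nat) \<Rightarrow> bool" where
  "conflict_free F m c \<longleftrightarrow> (\<forall>x. c (m x) = c x) \<and>
    (\<forall>x y. (x, y) \<in> F \<longrightarrow> m x \<noteq> x \<longrightarrow> m y \<noteq> y \<longrightarrow> c x \<noteq> c y)"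

text \<open>One halving per colour gives the factor \<open>2 ^ r\<close>. What has been achieved for
  earlier colours survives, because vertex sets only shrink and each halving keeps all arcs between
  kept vertices.\<close>

lemma eliminate_coloured_matching:
  fixes U :: "'a set" and F :: "('a \<times> 'a) set" and m :: "'a \<Rightarrow> 'a" and c :: "'a \<Rightarrow> nat"
  assumes "finite U" and "F \<subseteq> U \<times> U" and "single_valued F" and "single_valued (F\<inverse>)"
    and mm: "\<And>x. m (m x) = x"
    and cf: "conflict_free F m c"
  shows "\<exists>U' F'. U' \<subseteq> U \<and> F' \<subseteq> U' \<times> U' \<and> single_valued F' \<and> single_valued (F'\<inverse>) \<and>
    F' \<subseteq> F \<union> {(x, m x) | x. m x \<noteq> x \<and> c x < r} \<and>
    U' - Range F' \<subseteq> U - Range F \<and> U' - Domain F' \<subseteq> U - Domain F \<and>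
    card (U - Range F) \<le> 2 ^ r * card (U' - Range F') \<and>
    (\<forall>x y. (x, y) \<in> F \<longrightarrow> x \<in> U' \<longrightarrow> y \<in> U' \<longrightarrow> (x, y) \<in> F') \<and>
    (\<forall>x. m x \<noteq> x \<longrightarrow> c x < r \<longrightarrow> x \<in> U' \<longrightarrow> m x \<in> U' \<longrightarrow> (x, m x) \<in> F' \<or> (m x, x) \<in> F')"
proof (induction r)
  case 0
  show ?case using assms by (intro exI[of _ U] exI[of _ F]) auto
next
  case (Suc r)
  then obtain U1 F1 where 1: "U1 \<subseteq> U" "F1 \<subseteq> U1 \<times> U1" "single_valued F1" "single_valued (F1\<inverse>)"
    "F1 \<subseteq> F \<union> {(x, m x) | x. m x \<noteq> x \<and> c x < r}"
    "U1 - Range F1 \<subseteq> U - Range F" "U1 - Domain F1 \<subseteq> U - Domain F"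
    "card (U - Range F) \<le> 2 ^ r * card (U1 - Range F1)"
    "\<And>x y. (x, y) \<in> F \<Longrightarrow> x \<in> U1 \<Longrightarrow> y \<in> U1 \<Longrightarrow> (x, y) \<in> F1"
    "\<And>x. m x \<noteq> x \<Longrightarrow> c x < r \<Longrightarrow> x \<in> U1 \<Longrightarrow> m x \<in> U1 \<Longrightarrow> (x, m x) \<in> F1 \<or> (m x, x) \<in> F1"
    by auto
  have cm: "c (m x) = c x" and sep: "(x, y) \<in> F \<Longrightarrow> m x \<noteq> x \<Longrightarrow> m y \<noteq> y \<Longrightarrow> c x \<noteq> c y" for x y
    using cf unfolding conflict_free_def by auto
  \<comment> \<open>Only pairs of colour \<open>r\<close> with both ends still present are
    crossings; a pair that has lost an end can no longer span an edge.\<close>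
  define h where "h x = (if x \<in> U1 \<and> m x \<in> U1 \<and> c x = r then m x else x)" for x
  have hh: "h (h x) = x" for x unfolding h_def using mm cm by auto
  have hU: "x \<in> U1" if "h x \<noteq> x" for x using that unfolding h_def by (auto split: if_splits)
  \<comment> \<open>An arc of \<open>F1\<close> lies in \<open>F\<close>, where conflict-freeness
    applies, or is a matching edge of a colour below \<open>r\<close>.\<close>
  have hsep: "h x = x \<or> h y = y" if "(x, y) \<in> F1" for x y
  proof (rule ccontr)
    assume "\<not> ?thesis"
    then have *: "m x \<noteq> x" "m y \<noteq> y" "c x = r" "c y = r" unfolding h_def by (auto split: if_splits)
    then show False using 1(5) that sep[of x y] by auto
  qed
  have "finite U1" using 1(1) assms(1) finite_subset by blast
  from halve_linear_arcs[OF this 1(2-4) hh hU hsep]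
  obtain U2 F2 where 2: "U2 \<subseteq> U1" "F2 \<subseteq> U2 \<times> U2" "single_valued F2" "single_valued (F2\<inverse>)"
    "F2 \<subseteq> F1 \<union> {(x, h x) | x. h x \<noteq> x}"
    "U2 - Range F2 \<subseteq> U1 - Range F1" "U2 - Domain F2 \<subseteq> U1 - Domain F1"
    "card (U1 - Range F1) \<le> 2 * card (U2 - Range F2)"
    "\<And>x y. (x, y) \<in> F1 \<Longrightarrow> x \<in> U2 \<Longrightarrow> y \<in> U2 \<Longrightarrow> (x, y) \<in> F2"
    "\<And>x. h x \<noteq> x \<Longrightarrow> x \<in> U2 \<Longrightarrow> h x \<in> U2 \<Longrightarrow> (x, h x) \<in> F2 \<or> (h x, x) \<in> F2"
    by auto
  have "{(x, h x) | x. h x \<noteq> x} \<subseteq> {(x, m x) | x. m x \<noteq> x \<and> c x < Suc r}"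
    unfolding h_def by auto
  then have "F2 \<subseteq> F \<union> {(x, m x) | x. m x \<noteq> x \<and> c x < Suc r}"
    using 1(5) 2(5) by fastforce
  moreover have "card (U - Range F) \<le> 2 ^ Suc r * card (U2 - Range F2)"
  proof -
    have "2 ^ r * card (U1 - Range F1) \<le> 2 ^ r * (2 * card (U2 - Range F2))"
      using 2(8) by (rule mult_le_mono2)
    with 1(8) have "card (U - Range F) \<le> 2 ^ r * (2 * card (U2 - Range F2))" by (rule le_trans)
    then show ?thesis by (simp add: algebra_simps)
  qed
  moreover have "(x, m x) \<in> F2 \<or> (m x, x) \<in> F2"
    if x: "m x \<noteq> x" "c x < Suc r" "x \<in> U2" "m x \<in> U2" for x
  proof (cases "c x = r")
    case True
    then have "h x = m x" using x 2(1) unfolding h_def by auto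
    then show ?thesis using 2(10)[of x] x by simp
  next
    case False
    then have "(x, m x) \<in> F1 \<or> (m x, x) \<in> F1" using 1(10)[of x] x 2(1) by auto
    then show ?thesis using 2(9) x by blast
  qed
  ultimately show ?case
    using 1(1,6,7) 2(1-4,6,7) 1(9) 2(9)
    by (intro exI[of _ U2] exI[of _ F2]) (auto simp: subset_iff)
qed

section \<open>Four colours for the matching\<close>

text \<open>The colouring is greedy: a pair \<open>{x, m x}\<close> with \<open>x\<close> of least
  rank among the matched vertices is coloured last. It can conflict only through the successor of
  \<open>x\<close> and through the successor and predecessor of \<open>m x\<close>.\<close>

lemma matching_four_colouring:
  fixes F :: "('a \<times> 'a) set" and m :: "'a \<Rightarrow> 'a" and rank :: "'a \<Rightarrow> nat"
  assumes sv: "single_valued F" and svi: "single_valued (F\<inverse>)"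
    and rank: "\<And>x y. (x, y) \<in> F \<Longrightarrow> rank x < rank y"
    and "finite {x. m x \<noteq> x}" and "\<And>x. m (m x) = x" and "\<And>x. (x, m x) \<notin> F"
  shows "\<exists>c. conflict_free F m c \<and> range c \<subseteq> {..<4}"
  using assms(4-)
proof (induction "card {x. m x \<noteq> x}" arbitrary: m rule: less_induct)
  case less
  note fin = less.prems(1) and mm = less.prems(2) and mF = less.prems(3)
  show ?case
  proof (cases "\<exists>x. m x \<noteq> x")
    case False
    then show ?thesis by (intro exI[of _ "\<lambda>_. 0"]) (auto simp: conflict_free_def)
  next
    case True
    then obtain x where x: "m x \<noteq> x" and min: "\<And>y. m y \<noteq> y \<Longrightarrow> rank x \<le> rank y"
      using ex_has_least_nat[of "\<lambda>x. m x \<noteq> x" _ rank] by blast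
    define w where "w = m x"
    have w: "w \<noteq> x" "m x = w" "m w = x" using x mm unfolding w_def by auto
    have mz: "m z \<noteq> x" "m z \<noteq> w" if "z \<noteq> x" "z \<noteq> w" for z using w mm that by metis+
    define m' where "m' = m(x := x, w := w)"
    have sub: "{z. m' z \<noteq> z} \<subset> {z. m z \<noteq> z}" using x unfolding m'_def by auto
    have fin': "finite {z. m' z \<noteq> z}" using sub fin by (meson finite_subset psubset_imp_subset)
    have m'm': "m' (m' z) = z" for z
      using w mm[of z] mz[of z] unfolding m'_def by auto
    have irr: "(z, z) \<notin> F" for z using rank by blast
    have m'F: "(z, m' z) \<notin> F" for z using mF irr unfolding m'_def by auto
    obtain c where cf: "conflict_free F m' c" "range c \<subseteq> {..<4}"
      using less.hyps[OF psubset_card_mono[OF fin sub] fin' m'm' m'F] by blast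
    have c: "c z < 4" "c (m' z) = c z"
      "(a, b) \<in> F \<Longrightarrow> m' a \<noteq> a \<Longrightarrow> m' b \<noteq> b \<Longrightarrow> c a \<noteq> c b" for z a b
      using cf unfolding conflict_free_def by auto
    have le1: "\<exists>y. R `` {z} \<subseteq> {y}" if "single_valued R" for R :: "('a \<times> 'a) set" and z
      using that unfolding single_valued_def by blast
    \<comment> \<open>If such a neighbour does not exist, the witness is arbitrary and merely
      forbids one more colour; a fourth colour always remains.\<close>
    obtain y1 y2 y3 where y: "F `` {x} \<subseteq> {y1}" "F `` {w} \<subseteq> {y2}" "F\<inverse> `` {w} \<subseteq> {y3}"
      using le1[OF sv] le1[OF svi] by metis
    have "card {c y1, c y2, c y3} < card {..<4::nat}"
      by (auto simp: card_insert_if)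
    then have "\<not> {..<4} \<subseteq> {c y1, c y2, c y3}" using card_mono[of "{c y1, c y2, c y3}" "{..<4}"] by fastforce
    then obtain k where k: "k < 4" "k \<noteq> c y1" "k \<noteq> c y2" "k \<noteq> c y3" by auto
    define c' where "c' = c(x := k, w := k)"
    have "c' (m z) = c' z" for z
      using c(2)[of z] mz[of z] w unfolding c'_def m'_def by (cases "z = x"; cases "z = w") auto
    moreover have "c' z < 4" for z using c(1) k unfolding c'_def by auto
    moreover have "c' a \<noteq> c' b" if ab: "(a, b) \<in> F" "m a \<noteq> a" "m b \<noteq> b" for a b
    proof -
      \<comment> \<open>A matched predecessor of \<open>x\<close> would have smaller rank.\<close>
      have bx: "b \<noteq> x" using min[OF ab(2)] rank[OF ab(1)] by auto
      consider "a = x" | "a = w" | "b = w" "a \<noteq> x" "a \<noteq> w" | "a \<noteq> x" "a \<noteq> w" "b \<noteq> w" by blast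
      then show ?thesis
      proof cases
        case 1
        then have "b = y1" "b \<noteq> w" using ab y mF[of x] w by auto
        then show ?thesis using 1 bx k unfolding c'_def by auto
      next
        case 2
        then have "b = y2" "b \<noteq> w" using ab y irr by auto
        then show ?thesis using 2 bx k w unfolding c'_def by auto
      next
        case 3
        then have "a = y3" using ab y by auto
        then show ?thesis using 3 k w unfolding c'_def by auto
      next
        case 4
        then show ?thesis using c(3)[OF ab(1)] ab bx unfolding c'_def m'_def by auto
      qed
    qed
    ultimately have "conflict_free F m c' \<and> range c' \<subseteq> {..<4}" unfolding conflict_free_def by auto
    then show ?thesis by blast
  qed
qed

section \<open>From arcs back to paths\<close>

text \<open>If no path from \<open>s\<close> reached a sink, every path from \<open>s\<close> could
  be extended, and eventually it would have more than \<open>card U\<close> vertices. Cycles of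
  \<open>F\<close> do no harm, since a path starting at a source never enters one.\<close>

lemma path_from_source:
  fixes U :: "'a set" and F :: "('a \<times> 'a) set"
  assumes "finite U" and FU: "F \<subseteq> U \<times> U" and svi: "single_valued (F\<inverse>)"
    and s: "s \<in> U - Range F"
  shows "\<exists>p. p \<noteq> [] \<and> hd p = s \<and> last p \<in> U - Domain F \<and> distinct p \<and> set p \<subseteq> U \<and>
    (\<forall>i. Suc i < length p \<longrightarrow> (p ! i, p ! Suc i) \<in> F)"
proof (rule ccontr)
  assume no: "\<not> ?thesis"
  have "\<exists>p. length p = Suc n \<and> hd p = s \<and> distinct p \<and> set p \<subseteq> U \<and>
    (\<forall>i. Suc i < length p \<longrightarrow> (p ! i, p ! Suc i) \<in> F)" for n
  proof (induction n)
    case 0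
    show ?case using s by (intro exI[of _ "[s]"]) auto
  next
    case (Suc n)
    then obtain p where p: "length p = Suc n" "hd p = s" "distinct p" "set p \<subseteq> U"
      "\<And>i. Suc i < length p \<Longrightarrow> (p ! i, p ! Suc i) \<in> F" by blast
    then have ne: "p \<noteq> []" by auto
    then have "last p \<in> Domain F" using no p last_in_set by blast
    then obtain y where y: "(last p, y) \<in> F" by blast
    \<comment> \<open>The start \<open>s\<close> has no predecessor, and any later vertex of
      \<open>p\<close> already has its unique predecessor on \<open>p\<close>, before the last
      vertex.\<close>
    have "y \<notin> set p"
    proof
      assume "y \<in> set p"
      then obtain j where j: "j < length p" "p ! j = y" by (auto simp: in_set_conv_nth)
      show False
      proof (cases j)
        case 0
        then have "y = s" using j p(2) ne by (simp add: hd_conv_nth)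
        then show False using y s by blast
      next
        case (Suc i)
        then have "(p ! i, y) \<in> F" using p(5) j by auto
        then have "p ! i = last p" using y svi by (meson converseI single_valuedD)
        then have "p ! i = p ! n" using p(1) ne by (simp add: last_conv_nth)
        then show False using p(1,3) Suc j(1) by (auto simp: nth_eq_iff_index_eq)
      qed
    qed
    moreover have "((p @ [y]) ! i, (p @ [y]) ! Suc i) \<in> F" if "Suc i < length (p @ [y])" for i
    proof (cases "Suc i < length p")
      case True
      then show ?thesis using p(5) by (simp add: nth_append)
    next
      case False
      then have "i = n" using that p(1) by simp
      then show ?thesis using y p(1) ne by (simp add: nth_append last_conv_nth)
    qed
    ultimately show ?case using p y FU ne by (intro exI[of _ "p @ [y]"]) auto
  qed
  then obtain p where "length p = Suc (card U)" "distinct p" "set p \<subseteq> U" by blast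
  then show False using card_mono[OF \<open>finite U\<close>, of "set p"] distinct_card[of p] by simp
qed

lemma path_edges_rev: "path_edges (rev p) = path_edges p"
proof -
  have *: "path_edges q \<subseteq> path_edges (rev q)" for q :: "'a list"
  proof
    fix e assume "e \<in> path_edges q"
    then obtain i where i: "Suc i < length q" "e = {q ! i, q ! Suc i}" unfolding path_edges_def by blast
    define j where "j = length q - Suc (Suc i)"
    have "rev q ! j = q ! Suc i" "rev q ! Suc j = q ! i"
      using i unfolding j_def by (auto simp: rev_nth Suc_diff_Suc)
    moreover have "Suc j < length (rev q)" using i unfolding j_def by auto
    ultimately show "e \<in> path_edges (rev q)"
      using i(2) unfolding path_edges_def by (auto intro!: exI[of _ j])
  qed
  show ?thesis using *[of p] *[of "rev p"] by auto
qed

text \<open>One path is taken from each source and cycles are discarded. The vertex set of each path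
  is closed under successors and predecessors, so no edge within \<open>U\<close> leaves it.\<close>

lemma non_adjacent_paths_if_all_edges_linear:
  fixes V U X Y :: "'a set" and E :: "'a set set" and F :: "('a \<times> 'a) set"
  assumes "finite U" and "U \<subseteq> V" and FU: "F \<subseteq> U \<times> U"
    and sv: "single_valued F" and svi: "single_valued (F\<inverse>)"
    and FE: "\<And>x y. (x, y) \<in> F \<Longrightarrow> {x, y} \<in> E"
    and EF: "\<And>x y. {x, y} \<in> E \<Longrightarrow> x \<in> U \<Longrightarrow> y \<in> U \<Longrightarrow> (x, y) \<in> F \<or> (y, x) \<in> F"
    and X: "U - Range F \<subseteq> X" and Y: "U - Domain F \<subseteq> Y"
  shows "\<exists>Q. finite Q \<and> card Q = card (U - Range F) \<and> (\<forall>q\<in>Q. XY_path X Y V E q) \<and>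
           pairwise (non_adjacent E) Q"
proof -
  obtain path where "\<forall>s. s \<in> U - Range F \<longrightarrow> path s \<noteq> [] \<and> hd (path s) = s \<and>
    last (path s) \<in> U - Domain F \<and> distinct (path s) \<and> set (path s) \<subseteq> U \<and>
    (\<forall>i. Suc i < length (path s) \<longrightarrow> (path s ! i, path s ! Suc i) \<in> F)"
    using path_from_source[OF \<open>finite U\<close> FU svi]
      choice[of "\<lambda>s p. s \<in> U - Range F \<longrightarrow> p \<noteq> [] \<and> hd p = s \<and> last p \<in> U - Domain F \<and>
        distinct p \<and> set p \<subseteq> U \<and> (\<forall>i. Suc i < length p \<longrightarrow> (p ! i, p ! Suc i) \<in> F)"] by blast
  then have path: "path s \<noteq> []" "hd (path s) = s" "last (path s) \<in> U - Domain F"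
    "distinct (path s)" "set (path s) \<subseteq> U"
    "\<And>i. Suc i < length (path s) \<Longrightarrow> (path s ! i, path s ! Suc i) \<in> F"
    if "s \<in> U - Range F" for s
    using that by blast+
  have first: "path s ! 0 = s" if "s \<in> U - Range F" for s
    using path(1,2)[OF that] by (simp add: hd_conv_nth)
  have succ_closed: "y \<in> set (path s)"
    if s: "s \<in> U - Range F" and x: "x \<in> set (path s)" and xy: "(x, y) \<in> F" for s x y
  proof -
    obtain i where i: "i < length (path s)" "path s ! i = x"
      using x by (auto simp: in_set_conv_nth)
    have "x \<noteq> last (path s)" using path(3)[OF s] xy by blast
    then have "Suc i \<noteq> length (path s)" using i path(1)[OF s] by (metis diff_Suc_1 last_conv_nth)
    then have si: "Suc i < length (path s)" using i by simp
    then have "(x, path s ! Suc i) \<in> F" using path(6)[OF s] i by blast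
    then have "y = path s ! Suc i" using xy sv by (meson single_valuedD)
    then show ?thesis using si by simp
  qed
  have pred: "i > 0 \<and> y = path s ! (i - 1)"
    if s: "s \<in> U - Range F" and i: "i < length (path s)" and y: "(y, path s ! i) \<in> F" for s i y
  proof (cases i)
    case 0
    then show ?thesis using first[OF s] s y by auto
  next
    case (Suc j)
    then have "(path s ! j, path s ! i) \<in> F" using path(6)[OF s] i by blast
    then have "path s ! j = y" using y svi by (meson converseI single_valuedD)
    then show ?thesis using Suc by simp
  qed
  have pred_closed: "y \<in> set (path s)"
    if s: "s \<in> U - Range F" and "x \<in> set (path s)" "(y, x) \<in> F" for s x y
    using that pred[OF s] by (metis in_set_conv_nth less_imp_diff_less)
  have disj: "set (path s) \<inter> set (path t) = {}"
    if s: "s \<in> U - Range F" and t: "t \<in> U - Range F" and "s \<noteq> t" for s t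
  proof (rule ccontr)
    assume "\<not> ?thesis"
    then obtain i where i: "i < length (path s)" "path s ! i \<in> set (path t)"
      by (metis disjoint_iff in_set_conv_nth)
    \<comment> \<open>Walking back from a common vertex stays in \<open>path t\<close>, by closure
      under predecessors, and so reaches \<open>s\<close>, which can only be the start of
      \<open>path t\<close>.\<close>
    have "i < length (path s) \<Longrightarrow> path s ! i \<in> set (path t) \<Longrightarrow> path s ! 0 \<in> set (path t)" for i
    proof (induction i)
      case (Suc i)
      then show ?case using path(6)[OF s] pred_closed[OF t] by (meson Suc_lessD)
    qed
    then have "s \<in> set (path t)" using i first[OF s] by metis
    then obtain j where j: "j < length (path t)" "path t ! j = s" by (auto simp: in_set_conv_nth)
    show False
    proof (cases j)
      case 0
      then show False using j first[OF t] \<open>s \<noteq> t\<close> by simp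
    next
      case (Suc l)
      then show False using path(6)[OF t, of l] j s by auto
    qed
  qed
  define Q where "Q = path ` (U - Range F)"
  have "inj_on path (U - Range F)" using path(2) by (metis inj_onI)
  then have "card Q = card (U - Range F)" unfolding Q_def by (rule card_image)
  moreover have "XY_path X Y V E (path s)" if "s \<in> U - Range F" for s
    using path[OF that] X Y FE that \<open>U \<subseteq> V\<close>
    unfolding XY_path_def is_path_def path_edges_def by auto
  moreover have "pairwise (non_adjacent E) Q"
  proof (rule pairwiseI)
    fix p q assume pq: "p \<in> Q" "q \<in> Q" "p \<noteq> q"
    then obtain s t where st: "s \<in> U - Range F" "t \<in> U - Range F" "p = path s" "q = path t" "s \<noteq> t"
      unfolding Q_def by blast
    have d: "set p \<inter> set q = {}" using disj st by blast
    have "{u, v} \<notin> E" if "u \<in> set p" "v \<in> set q" for u v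
    proof
      assume "{u, v} \<in> E"
      then have "(u, v) \<in> F \<or> (v, u) \<in> F" using EF that path(5) st by blast
      then have "v \<in> set p" using succ_closed[OF st(1)] pred_closed[OF st(1)] that(1) st(3) by blast
      then show False using d that by blast
    qed
    then show "non_adjacent E p q" using d unfolding non_adjacent_def vertex_disjoint_def by blast
  qed
  ultimately show ?thesis using \<open>finite U\<close> unfolding Q_def by (intro exI[of _ Q]) (auto simp: Q_def)
qed

section \<open>From the given paths to arcs and a matching\<close>

text \<open>With all paths directed from \<open>X\<close> to \<open>Y\<close>, sources lie in
  \<open>X\<close> and sinks in \<open>Y\<close>, and both properties pass to the final system
  because its sources and sinks are among the old ones.\<close>

lemma non_adjacent_paths_oriented:
  fixes V X Y :: "'a set" and E :: "'a set set" and P :: "'a list set"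
  assumes G: "finite_graph V E" and "finite P"
    and paths: "\<And>p. p \<in> P \<Longrightarrow> is_path V E p \<and> hd p \<in> X \<and> last p \<in> Y"
    and disj: "pairwise vertex_disjoint P"
    and one: "\<And>v. v \<in> verts_of P \<Longrightarrow> card {e \<in> E - edges_of P. v \<in> e} \<le> 1"
  shows "\<exists>Q. finite Q \<and> card P \<le> 16 * card Q \<and> (\<forall>q\<in>Q. XY_path X Y V E q) \<and>
           pairwise (non_adjacent E) Q"
proof -
  interpret finite_graph V E by (rule G)
  have ne: "p \<noteq> []" and dist: "distinct p" and pV: "set p \<subseteq> V" and pE: "path_edges p \<subseteq> E"
    if "p \<in> P" for p using paths[OF that] unfolding is_path_def by auto
  define U where "U = verts_of P"
  define F where "F = {(p ! i, p ! Suc i) | p i. p \<in> P \<and> Suc i < length p}"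
  have UV: "U \<subseteq> V" unfolding U_def verts_of_def using pV by auto
  have finU: "finite U" using UV finite_verts finite_subset by blast
  have finE: "finite E" using edges_wf finite_verts by (meson PowI finite_Pow_iff finite_subset subsetI)
  have same: "p = q \<and> i = j" if "p \<in> P" "q \<in> P" "i < length p" "j < length q" "p ! i = q ! j" for p q i j
  proof -
    have "p = q"
      using that disj nth_mem unfolding pairwise_def vertex_disjoint_def by (metis disjoint_iff)
    then show ?thesis using that dist nth_eq_iff_index_eq by blast
  qed
  have nthU: "p ! i \<in> U" if "p \<in> P" "i < length p" for p i
    using that nth_mem unfolding U_def verts_of_def by blast
  have FU: "F \<subseteq> U \<times> U" unfolding F_def using nthU by auto
  have sv: "single_valued F"
  proof (rule single_valuedI)
    fix x y z assume "(x, y) \<in> F" "(x, z) \<in> F"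
    then obtain p i q j where "p \<in> P" "Suc i < length p" "x = p ! i" "y = p ! Suc i"
      "q \<in> P" "Suc j < length q" "x = q ! j" "z = q ! Suc j" unfolding F_def by blast
    then show "y = z" using same[of p q i j] by auto
  qed
  have svi: "single_valued (F\<inverse>)"
  proof (rule single_valuedI)
    fix x y z assume "(x, y) \<in> F\<inverse>" "(x, z) \<in> F\<inverse>"
    then obtain p i q j where "p \<in> P" "Suc i < length p" "y = p ! i" "x = p ! Suc i"
      "q \<in> P" "Suc j < length q" "z = q ! j" "x = q ! Suc j" unfolding F_def by blast
    then show "y = z" using same[of p q "Suc i" "Suc j"] by auto
  qed
  have PF: "{x, y} \<in> edges_of P \<longleftrightarrow> (x, y) \<in> F \<or> (y, x) \<in> F" for x y
    unfolding edges_of_def path_edges_def F_def by (auto simp: doubleton_eq_iff)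
  have PE: "edges_of P \<subseteq> E" unfolding edges_of_def using pE by blast
  have hd0: "hd p = p ! 0" "0 < length p" if "p \<in> P" for p using ne[OF that] by (auto simp: hd_conv_nth)
  have src: "U - Range F = hd ` P"
  proof (intro equalityI subsetI)
    fix x assume x: "x \<in> U - Range F"
    then obtain p i where p: "p \<in> P" "i < length p" "x = p ! i"
      unfolding U_def verts_of_def by (auto simp: in_set_conv_nth)
    have "i = 0"
    proof (rule ccontr)
      assume "i \<noteq> 0"
      then obtain j where "i = Suc j" using not0_implies_Suc by blast
      then have "(p ! j, x) \<in> F" using p unfolding F_def by auto
      then show False using x by blast
    qed
    then show "x \<in> hd ` P" using p hd0 by auto
  next
    fix x assume "x \<in> hd ` P"
    then obtain p where p: "p \<in> P" "x = p ! 0" "0 < length p" using hd0 by auto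
    have "x \<notin> Range F"
    proof
      assume "x \<in> Range F"
      then obtain q i where "q \<in> P" "Suc i < length q" "x = q ! Suc i" unfolding F_def by auto
      then show False using same[of p q 0 "Suc i"] p by auto
    qed
    then show "x \<in> U - Range F" using p nthU by auto
  qed
  have snk: "U - Domain F \<subseteq> Y"
  proof
    fix x assume x: "x \<in> U - Domain F"
    then obtain p i where p: "p \<in> P" "i < length p" "x = p ! i"
      unfolding U_def verts_of_def by (auto simp: in_set_conv_nth)
    have "\<not> Suc i < length p"
    proof
      assume "Suc i < length p"
      then have "(x, p ! Suc i) \<in> F" using p unfolding F_def by auto
      then show False using x by blast
    qed
    then have "i = length p - 1" using p by auto
    then have "x = last p" using p ne by (simp add: last_conv_nth)
    then show "x \<in> Y" using paths p by blast
  qed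
  have "inj_on hd P" using same[of _ _ 0 0] hd0 by (metis inj_onI)
  then have cardP: "card (U - Range F) = card P" using src by (simp add: card_image)
  \<comment> \<open>The position on the unique path through \<open>x\<close>, which increases along
    arcs.\<close>
  define rank where "rank x = (SOME i. \<exists>p\<in>P. i < length p \<and> p ! i = x)" for x
  have rank_nth: "rank (p ! i) = i" if "p \<in> P" "i < length p" for p i
    unfolding rank_def by (rule some_equality) (use that same in blast)+
  have rank_less: "rank x < rank y" if "(x, y) \<in> F" for x y
    using that rank_nth unfolding F_def by fastforce
  \<comment> \<open>Edges leaving \<open>U\<close> are ignored, since all new paths stay inside
    \<open>U\<close>. The degree hypothesis makes the rest a matching.\<close>
  define M where "M x y \<longleftrightarrow> {x, y} \<in> E - edges_of P \<and> x \<in> U \<and> y \<in> U" for x y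
  have M_sym: "M x y \<Longrightarrow> M y x" for x y unfolding M_def by (simp add: insert_commute)
  have M_irr: "\<not> M x x" for x using edges_wf[of "{x, x}"] unfolding M_def by auto
  have M_uniq: "y = z" if "M x y" "M x z" for x y z
  proof -
    let ?S = "{e \<in> E - edges_of P. x \<in> e}"
    have "card ?S \<le> 1" using one that unfolding M_def U_def by auto
    moreover have "finite ?S" using finE by simp
    moreover have "{x, y} \<in> ?S" "{x, z} \<in> ?S" using that unfolding M_def by auto
    ultimately have "{x, y} = {x, z}" using card_le_Suc0_iff_eq by fastforce
    then show ?thesis by (auto simp: doubleton_eq_iff)
  qed
  define m where "m x = (if \<exists>y. M x y then (THE y. M x y) else x)" for x
  have m_eq: "m x = y" if "M x y" for x y
    using that M_uniq unfolding m_def by (metis the_equality)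
  have m_M: "M x (m x)" if "m x \<noteq> x" for x
    using that m_eq unfolding m_def by (metis (full_types) m_def)
  have mm: "m (m x) = x" for x
    using m_M m_eq M_sym by (cases "m x = x") auto
  have finm: "finite {x. m x \<noteq> x}"
    by (rule finite_subset[OF _ finU]) (use m_M M_def in auto)
  have mF: "(x, m x) \<notin> F" for x
  proof (cases "m x = x")
    case True
    then show ?thesis using rank_less by fastforce
  next
    case False
    then show ?thesis using m_M[OF False] PF unfolding M_def by blast
  qed
  obtain c where c: "conflict_free F m c" "range c \<subseteq> {..<4}"
    using matching_four_colouring[of F rank m, OF sv svi rank_less finm mm mF] by blast
  \<comment> \<open>All colours are below 4, so after four rounds every matching edge between kept
    vertices is an arc, at a loss of a factor \<open>2 ^ 4 = 16\<close>.\<close>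
  obtain U' F' where *: "U' \<subseteq> U" "F' \<subseteq> U' \<times> U'" "single_valued F'" "single_valued (F'\<inverse>)"
    "F' \<subseteq> F \<union> {(x, m x) | x. m x \<noteq> x \<and> c x < 4}"
    "U' - Range F' \<subseteq> U - Range F" "U' - Domain F' \<subseteq> U - Domain F"
    "card (U - Range F) \<le> 2 ^ 4 * card (U' - Range F')"
    "\<And>x y. (x, y) \<in> F \<Longrightarrow> x \<in> U' \<Longrightarrow> y \<in> U' \<Longrightarrow> (x, y) \<in> F'"
    "\<And>x. m x \<noteq> x \<Longrightarrow> c x < 4 \<Longrightarrow> x \<in> U' \<Longrightarrow> m x \<in> U' \<Longrightarrow> (x, m x) \<in> F' \<or> (m x, x) \<in> F'"
    using eliminate_coloured_matching[of U F m c 4, OF finU FU sv svi mm c(1)] by auto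
  have F'E: "{x, y} \<in> E" if "(x, y) \<in> F'" for x y
  proof -
    have "(x, y) \<in> F \<or> M x y" using that *(5) m_M by auto
    then show ?thesis using PF PE unfolding M_def by blast
  qed
  have EF': "(x, y) \<in> F' \<or> (y, x) \<in> F'" if "{x, y} \<in> E" "x \<in> U'" "y \<in> U'" for x y
  proof (cases "{x, y} \<in> edges_of P")
    case True
    then show ?thesis using PF *(9) that by blast
  next
    case False
    then have "M x y" using that *(1) unfolding M_def by blast
    then have "m x = y" "x \<noteq> y" using m_eq M_irr by auto
    then show ?thesis using *(10)[of x] c(2) that by auto
  qed
  have "hd ` P \<subseteq> X" using paths by blast
  then have X': "U' - Range F' \<subseteq> X" using *(6) src by simp
  have Y': "U' - Domain F' \<subseteq> Y" using *(7) snk by blast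
  have U': "finite U'" "U' \<subseteq> V" using *(1) finU UV finite_subset by auto
  obtain Q where "finite Q" "card Q = card (U' - Range F')"
    "\<forall>q\<in>Q. XY_path X Y V E q" "pairwise (non_adjacent E) Q"
    using non_adjacent_paths_if_all_edges_linear[of U' V F' E X Y, OF U' *(2-4) F'E EF' X' Y'] by blast
  then show ?thesis using *(8) cardP by (intro exI[of _ Q]) auto
qed

theorem theorem1p7:
  fixes k :: nat and V :: "'a set" and E :: "'a set set" and X Y :: "'a set"
  assumes "k > 0"
    and "finite_graph V E"
    and "X \<subseteq> V" and "Y \<subseteq> V"
    and "\<exists>P. card P \<ge> 16 * k \<and> (\<forall>p\<in>P. XY_path X Y V E p) \<and> pairwise vertex_disjoint P \<and>
           (\<forall>v\<in>verts_of P. card {e \<in> E - edges_of P. v \<in> e} \<le> 1)"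
  shows "\<exists>Q. finite Q \<and> card Q \<ge> k \<and> (\<forall>q\<in>Q. XY_path X Y V E q) \<and>
           pairwise (non_adjacent E) Q"
proof -
  obtain P where P: "card P \<ge> 16 * k" "\<And>p. p \<in> P \<Longrightarrow> XY_path X Y V E p" "pairwise vertex_disjoint P"
    "\<And>v. v \<in> verts_of P \<Longrightarrow> card {e \<in> E - edges_of P. v \<in> e} \<le> 1"
    using assms(5) by blast
  \<comment> \<open>An infinite set has \<open>card\<close> 0, but \<open>16 * k\<close> is
    positive.\<close>
  have "finite P" using P(1) assms(1) by (metis card.infinite le_zero_eq mult_is_0 not_gr0 zero_neq_numeral)
  define orient where "orient p = (if hd p \<in> X \<and> last p \<in> Y then p else rev p)" for p
  have set_orient: "set (orient p) = set p" and edges_orient: "path_edges (orient p) = path_edges p" for p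
    unfolding orient_def by (auto simp: path_edges_rev)
  \<comment> \<open>Reversal keeps the vertex set, so two paths with the same orientation would
    meet, and disjointness makes them equal.\<close>
  have inj: "inj_on orient P"
  proof (rule inj_onI)
    fix p q assume pq: "p \<in> P" "q \<in> P" "orient p = orient q"
    then have "set p = set q" using set_orient by metis
    moreover have "set p \<noteq> {}" using P(2)[OF pq(1)] unfolding XY_path_def is_path_def by simp
    ultimately have "\<not> vertex_disjoint p q" unfolding vertex_disjoint_def by simp
    then show "p = q" using P(3) pq(1,2) unfolding pairwise_def by blast
  qed
  have "is_path V E (orient p) \<and> hd (orient p) \<in> X \<and> last (orient p) \<in> Y" if "p \<in> P" for p
  proof -
    have "is_path V E (orient p)"
      using P(2)[OF that] set_orient[of p] edges_orient[of p]
      unfolding XY_path_def is_path_def by (auto simp: orient_def)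
    then show ?thesis
      using P(2)[OF that] unfolding XY_path_def is_path_def orient_def
      by (auto simp: hd_rev last_rev)
  qed
  moreover have "pairwise vertex_disjoint (orient ` P)"
    using P(3) set_orient unfolding pairwise_image vertex_disjoint_def by (auto simp: pairwise_def)
  moreover have "verts_of (orient ` P) = verts_of P" "edges_of (orient ` P) = edges_of P"
    unfolding verts_of_def edges_of_def using set_orient edges_orient by auto
  ultimately obtain Q where "finite Q" "card (orient ` P) \<le> 16 * card Q"
    "\<forall>q\<in>Q. XY_path X Y V E q" "pairwise (non_adjacent E) Q"
    using non_adjacent_paths_oriented[OF assms(2), of "orient ` P" X Y] \<open>finite P\<close> P(4) by auto
  moreover have "card (orient ` P) = card P" using inj by (rule card_image)
  ultimately show ?thesis using P(1) by (intro exI[of _ Q]) auto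
qed

end
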